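(* Let $V$ be a finite set with $n=|V|$, let $k\ge 2$ be an integer, and let $P=\{1,\dots,k\}$. Let $\mathcal{R}^{\bar Z}_{\mathrm{BQO}}\subset\mathbb{R}^{n\times k}\times\mathbb{R}^{n\times n}$ and $\mathcal{R}_{\mathrm{MISDO\text{-}II}}\subset\mathbb{R}^{n\times n}$ be the sets defined in the context, and let $\operatorname{proj}_{\bar Z}\mathcal{R}^{\bar Z}_{\mathrm{BQO}}=\{\bar Z : \exists x,\ (x,\bar Z)\in\mathcal{R}^{\bar Z}_{\mathrm{BQO}}\}$. Then $\operatorname{proj}_{\bar Z}\mathcal{R}^{\bar Z}_{\mathrm{BQO}}\subseteq\mathcal{R}_{\mathrm{MISDO\text{-}II}}$.
   Context: $V$ is the vertex set of the graph in a max $k$-cut instance. $e\in\mathbb{R}^n$ is the all-ones vector, and $A\succeq 0$ means that $A$ is symmetric positive semidefinite. For $x=(x_{vj})_{v\in V,\,j\in P}\in[0,1]^{n\times k}$ and $j\in P$, let $\mathbf{x}_j\in[0,1]^n$ be the vector with entries $(\mathbf{x}_j)_v=x_{vj}$ for $v\in V$, and let $D^x$ be the $n\times n$ diagonal matrix with $D^x_{vv}=1-\sum_{j\in P}x_{vj}^2$. The lifted continuous relaxation of the binary quadratic optimization (BQO) formulation in $\bar Z$-space is $$\mathcal{R}^{\bar Z}_{\mathrm{BQO}}=\Big\{(x,\bar Z)\in[0,1]^{n\times k}\times\mathbb{R}^{n\times n} : \sum_{j\in P}x_{vj}=1\ \ \forall v\in V,\quad \bar Z=\frac{1}{k-1}\Big(kD^x-ee^T+k\sum_{j\in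 P}\mathbf{x}_j\mathbf{x}_j^T\Big)\Big\}.$$ The second mixed integer semidefinite optimization (MISDO-II) formulation has feasible set consisting of all $\bar Z\in\{-\frac{1}{k-1},1\}^{n\times n}$ with $\bar Z_{vv}=1$ for all $v\in V$ and $\bar Z\succeq 0$. Its continuous relaxation is $$\mathcal{R}_{\mathrm{MISDO\text{-}II}}=\Big\{\bar Z\in\big[-\tfrac{1}{k-1},1\big]^{n\times n} : \bar Z_{vv}=1\ \ \forall v\in V,\quad \bar Z\succeq 0\Big\}.$$ *)

theory Defs
  imports "HOL-Analysis.Analysis"
begin

text \<open>
  The vertex set \<open>V\<close> and the set of parts \<open>P\<close> are the finite index types \<open>'v\<close> and \<open>'p\<close>, so
  \<open>n = CARD('v)\<close> and \<open>k = CARD('p)\<close>. A matrix \<open>x :: real^'p^'v\<close> has the entry \<open>x $ v $ j\<close> in row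
  \<open>v\<close> and column \<open>j\<close>, and \<open>column j x\<close> is the vector of its \<open>j\<close>-th column. The numeral
  \<open>1 :: real^'v\<close> is the all-ones vector.
\<close>

definition psd :: "real^'v^'v \<Rightarrow> bool" where
  "psd A \<longleftrightarrow> transpose A = A \<and> (\<forall>y. 0 \<le> y \<bullet> (A *v y))"

definition outer :: "real^'v \<Rightarrow> real^'v \<Rightarrow> real^'v^'v" where
  "outer a b = (\<chi> u v. a $ u * b $ v)"

definition diag_D :: "real^'p^'v \<Rightarrow> real^'v^'v" where
  "diag_D x = (\<chi> u v. if u = v then 1 - (\<Sum>j\<in>UNIV. (x $ v $ j)\<^sup>2) else 0)"

definition R_BQO :: "((real^'p^'v) \<times> (real^'v^'v)) set" where
  "R_BQO = {(x, Z).
     (\<forall>v j. x $ v $ j \<in> {0..1}) \<and>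
     (\<forall>v. (\<Sum>j\<in>UNIV. x $ v $ j) = 1) \<and>
     Z = (1 / (real CARD('p) - 1)) *\<^sub>R
           (real CARD('p) *\<^sub>R diag_D x - outer 1 1
             + real CARD('p) *\<^sub>R (\<Sum>j\<in>UNIV. outer (column j x) (column j x)))}"

definition R_MISDO_II :: "nat \<Rightarrow> (real^'v^'v) set" where
  "R_MISDO_II k = {Z.
     (\<forall>u v. Z $ u $ v \<in> {- 1 / (real k - 1)..1}) \<and>
     (\<forall>v. Z $ v $ v = 1) \<and>
     psd Z}"

definition proj_Z :: "((real^'p^'v) \<times> (real^'v^'v)) set \<Rightarrow> (real^'v^'v) set" where
  "proj_Z R = {Z. \<exists>x. (x, Z) \<in> R}"

end

theory Submission
  imports Defs
begin

text \<open>
  Let \<open>(x, Z)\<close> be a point of the lifted relaxation, so that each row of \<open>x\<close> is a probability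
  vector on the \<open>k\<close> parts. The entries of \<open>Z\<close> are read off from its definition: on the diagonal the
  term \<open>1 - \<Sum>j. (x $ v $ j)\<^sup>2\<close> of \<open>diag_D x\<close> cancels the squares contributed by the outer
  products, which leaves \<open>1\<close>. Off the diagonal the entry is \<open>(k s - 1) / (k - 1)\<close>, where \<open>s\<close> is the
  inner product of two probability vectors, so \<open>0 \<le> s \<le> 1\<close>.

  For semidefiniteness, the quadratic form of \<open>(k - 1) Z\<close> at \<open>y\<close> is
  \<open>k (y \<bullet> (D y)) - (\<Sum>v. y $ v)\<^sup>2 + k (\<Sum>j. (y \<bullet> column j x)\<^sup>2)\<close>. The first term is nonnegative
  because \<open>D\<close> is a nonnegative diagonal matrix. Since the columns of \<open>x\<close> add up to the all-ones
  vector, \<open>\<Sum>v. y $ v = \<Sum>j. y \<bullet> column j x\<close>, and the Cauchy-Schwarz inequality for these \<open>k\<close>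
  numbers bounds the second term by the third.
\<close>

lemma quadratic_form_outer:
  fixes y a b :: "real^'v::finite"
  shows "y \<bullet> (outer a b *v y) = (y \<bullet> a) * (y \<bullet> b)"
proof -
  have "outer a b *v y = (y \<bullet> b) *\<^sub>R a"
    by (simp add: vec_eq_iff outer_def matrix_vector_mult_def inner_vec_def
        sum_distrib_left sum_distrib_right mult_ac)
  then show ?thesis
    by simp
qed

lemma quadratic_form_sum:
  fixes y :: "real^'v::finite" and M :: "'i \<Rightarrow> real^'v^'v"
  shows "y \<bullet> ((\<Sum>i\<in>I. M i) *v y) = (\<Sum>i\<in>I. y \<bullet> (M i *v y))"
  by (induction I rule: infinite_finite_induct)
    (simp_all add: matrix_vector_mult_add_rdistrib inner_add_right)

lemma quadratic_form_diag_D: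
  fixes x :: "real^'p::finite^'v::finite"
  shows "y \<bullet> (diag_D x *v y) = (\<Sum>v\<in>UNIV. (1 - (\<Sum>j\<in>UNIV. (x $ v $ j)\<^sup>2)) * (y $ v)\<^sup>2)"
proof -
  have "(diag_D x *v y) $ v = (1 - (\<Sum>j\<in>UNIV. (x $ v $ j)\<^sup>2)) * y $ v" for v
    by (simp add: matrix_vector_mult_def diag_D_def if_distrib [where f = "\<lambda>c. c * _"]
        cong: if_cong)
  then show ?thesis
    by (simp add: inner_vec_def power2_eq_square mult_ac)
qed

lemma weighted_average_unit_interval:
  fixes p q :: "'p::finite \<Rightarrow> real"
  assumes "\<And>j. 0 \<le> p j" and "\<And>j. 0 \<le> q j" and "\<And>j. q j \<le> 1" and "(\<Sum>j\<in>UNIV. p j) = 1"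
  shows "0 \<le> (\<Sum>j\<in>UNIV. p j * q j)" and "(\<Sum>j\<in>UNIV. p j * q j) \<le> 1"
proof -
  show "0 \<le> (\<Sum>j\<in>UNIV. p j * q j)"
    using assms by (simp add: sum_nonneg)
  have "(\<Sum>j\<in>UNIV. p j * q j) \<le> (\<Sum>j\<in>UNIV. p j)"
    using assms by (intro sum_mono) (simp add: mult_left_le)
  then show "(\<Sum>j\<in>UNIV. p j * q j) \<le> 1"
    using assms by simp
qed

theorem corollary1:
  fixes k :: nat
  assumes "k \<ge> 2" and "CARD('p::finite) = k"
  shows "proj_Z (R_BQO :: ((real^'p^'v::finite) \<times> (real^'v^'v)) set) \<subseteq> R_MISDO_II k"
proof
  fix Z :: "real^'v^'v"
  assume "Z \<in> proj_Z (R_BQO :: ((real^'p^'v) \<times> (real^'v^'v)) set)"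
  then obtain x :: "real^'p^'v"
    where x01: "\<And>v j. 0 \<le> x $ v $ j" "\<And>v j. x $ v $ j \<le> 1"
      and row: "\<And>v. (\<Sum>j\<in>UNIV. x $ v $ j) = 1"
      and Z: "Z = (1 / (real k - 1)) *\<^sub>R (real k *\<^sub>R diag_D x - outer 1 1
             + real k *\<^sub>R (\<Sum>j\<in>UNIV. outer (column j x) (column j x)))"
    using assms(2) by (auto simp: proj_Z_def R_BQO_def)
  have k1: "real k - 1 > 0"
    using assms(1) by simp
  define s where "s u v = (\<Sum>j\<in>UNIV. x $ u $ j * x $ v $ j)" for u v
  have s: "0 \<le> s u v" "s u v \<le> 1" for u v
    unfolding s_def by (rule weighted_average_unit_interval; simp add: x01 row)+
  have entry: "Z $ u $ v = ((if u = v then real k * (1 - s u u) else 0) - 1 + real k * s u v)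
                 / (real k - 1)" for u v
    by (simp add: Z diag_D_def outer_def s_def column_def power2_eq_square)
  have diag: "Z $ v $ v = 1" for v
    using k1 by (simp add: entry algebra_simps)
  have range: "Z $ u $ v \<in> {- 1 / (real k - 1)..1}" for u v
  proof (cases "u = v")
    case True
    have "- 1 / (real k - 1) \<le> 0"
      using k1 by simp
    then show ?thesis
      unfolding True diag atLeastAtMost_iff by linarith
  next
    case False
    then have "Z $ u $ v = (real k * s u v - 1) / (real k - 1)"
      by (simp add: entry)
    moreover have "- 1 \<le> real k * s u v - 1" "real k * s u v - 1 \<le> real k - 1"
      using s [of u v] by (simp_all add: mult_left_le)
    ultimately show ?thesis
      using k1 divide_right_mono [of "- 1" "real k * s u v - 1" "real k - 1"] by simp
  qed
  have "s u v = s v u" for u v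
    by (simp add: s_def mult.commute)
  then have sym: "transpose Z = Z"
    by (simp add: vec_eq_iff transpose_def entry)
  have "0 \<le> y \<bullet> (Z *v y)" for y
  proof -
    have col: "(\<Sum>j\<in>UNIV. column j x) = 1"
      by (simp add: vec_eq_iff column_def row)
    have "(y \<bullet> 1)\<^sup>2 = (\<Sum>j\<in>UNIV. y \<bullet> column j x)\<^sup>2"
      by (simp flip: col add: inner_sum_right)
    also have "\<dots> \<le> real k * (\<Sum>j\<in>UNIV. (y \<bullet> column j x)\<^sup>2)"
      using sum_squared_le_sum_of_squares [of "\<lambda>j. y \<bullet> column j x" UNIV] assms(2)
      by (simp add: mult.commute)
    finally have cs: "(y \<bullet> 1)\<^sup>2 \<le> real k * (\<Sum>j\<in>UNIV. (y \<bullet> column j x)\<^sup>2)" .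
    have "0 \<le> y \<bullet> (diag_D x *v y)"
      unfolding quadratic_form_diag_D
      using s by (intro sum_nonneg) (simp add: s_def power2_eq_square)
    then have D: "0 \<le> real k * (y \<bullet> (diag_D x *v y))"
      by simp
    have "y \<bullet> (Z *v y) = (real k * (y \<bullet> (diag_D x *v y)) - (y \<bullet> 1)\<^sup>2
            + real k * (\<Sum>j\<in>UNIV. (y \<bullet> column j x)\<^sup>2)) / (real k - 1)"
      by (simp add: Z matrix_vector_mult_add_rdistrib matrix_vector_mult_diff_rdistrib
          scaleR_matrix_vector_assoc [symmetric] inner_add_right inner_diff_right
          quadratic_form_outer quadratic_form_sum power2_eq_square)
    then show ?thesis
      using cs D k1 by simp
  qed
  with sym range diag show "Z \<in> R_MISDO_II k"
    by (simp add: R_MISDO_II_def psd_def)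
qed

end
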